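(* Let $G$ be any countable group for which the space of nonzero homogeneous quasimorphisms is not empty. For a given nonzero homogeneous quasimorphism $\mu$ on $G$, there is an injection of $G$, induced by $\mu$, into $QI^h(\mathcal{L},d)$. Further, denote by $\Psi^\mu$ the action of the image of $G$ on $\mathcal{L}$ induced by $\mu$, and consider two representations to be equivalent if the difference, with respect to $h$, between the orbits of their actions, for any point in $\mathcal{L}$, is universally bounded. Then there is an injection of the projective space of the space of homogeneous quasimorphisms on $G$ into the space of equivalence classes of the representations. In other words, if $\mu$ and $m$ are linearly independent, then $[\Psi^\mu]\neq[\Psi^m]$, where the brackets stand for equivalence classes.
   Context: A quasimorphism on a group $G$ is a function $\mu:G\to\mathbb{R}$ for which there is a constant $B$ with $|\mu(xy)-\mu(x)-\mu(y)|\le B$ for all $x,y\in G$; it is homogeneous if $\mu(g^n)=n\mu(g)$ for all $g\in G$ and all integers $n$. The homogenization of a quasimorphism $\mu_0$ is $g\mapsto\lim_{n\to\infty}\mu_0(g^n)/n$. Let $H$ be a discrete countable (infinite) subset of the open interval $(0,1)$, and let $\mathcal{L}=H\times\mathbb{Z}\subseteq\mathbb{R}^2$ with the metric $d=d_1+d_2$, where $d_1,d_2$ are the usual induced metrics on $H$ and $\mathbb{Z}$ respectively. Let $h:\mathcal{L}\to\mathbb{Z}$ be the projection to the $\mathbb{Z}$ component. $QI^h(\mathcal{L},d)$ denotes the space of all quasi-isometries $g$ of $(\mathcal{L},d)$ for which there is a constant $B$, depending on $g$, such that $|(h(g\cdot x)-h(g\cdot y))-(h(x)-h(y))|\le B$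 for all $x,y\in\mathcal{L}$. "Induced by $\mu$" refers to the following construction: choose a quasimorphism $\mu_0:G\to\mathbb{Z}$ whose homogenization is $\mu$, with $\mu_0$ equal to $0$ at the identity and $\mu_0^{-1}(n)\neq\emptyset$ for all $n\in\mathbb{Z}$ (the sets $\mu_0^{-1}(n)$ being assumed, without loss of generality, infinite); biject $\mu_0^{-1}(n)$ with $H\times\{n\}$ for each $n$, thereby identifying $G$ with $\mathcal{L}$; and let $G$ act on $\mathcal{L}$ by transporting the left multiplication action of $G$ on itself through this identification. Representations are actions of $G$ on $\mathcal{L}$ by elements of $QI^h(\mathcal{L},d)$. The equivalence of two representations $\Psi,\Phi$ means that $|h(\Psi(g)x)-h(\Phi(g)x)|$ is universally bounded over $g\in G$ and $x\in\mathcal{L}$.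
   Formalization: If G has no integer quasimorphism with homogenization μ and all fibres infinite (e.g. G = ℤ), the action induced by μ is undefined; there it is taken to be the one built from G×ℤ with μ pulled back, restricted to G. The injection sends each line to [Ψ^μ] for a chosen μ on that line. *)

theory Defs
  imports "HOL-Analysis.Analysis" "HOL-Algebra.Group_Action" "HOL-Algebra.Elementary_Groups"
begin

section \<open>Quasimorphisms\<close>

definition quasimorphism :: "('a, 'b) monoid_scheme \<Rightarrow> ('a \<Rightarrow> real) \<Rightarrow> bool" where
  "quasimorphism G \<mu> \<longleftrightarrow>
     (\<exists>B. \<forall>x\<in>carrier G. \<forall>y\<in>carrier G. \<bar>\<mu> (x \<otimes>\<^bsub>G\<^esub> y) - \<mu> x - \<mu> y\<bar> \<le> B)"

definition homogeneous :: "('a, 'b) monoid_scheme \<Rightarrow> ('a \<Rightarrow> real) \<Rightarrow> bool" where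
  "homogeneous G \<mu> \<longleftrightarrow>
     (\<forall>g\<in>carrier G. \<forall>n::int. \<mu> (g [^]\<^bsub>G\<^esub> n) = of_int n * \<mu> g)"

definition homogenization_of ::
  "('a, 'b) monoid_scheme \<Rightarrow> ('a \<Rightarrow> real) \<Rightarrow> ('a \<Rightarrow> real) \<Rightarrow> bool" where
  "homogenization_of G \<mu>0 \<mu> \<longleftrightarrow>
     (\<forall>g\<in>carrier G. (\<lambda>n::nat. \<mu>0 (g [^]\<^bsub>G\<^esub> n) / real n) \<longlonglongrightarrow> \<mu> g)"

text \<open>Functions on the group are represented by functions that are \<^const>\<open>undefined\<close> off the
  carrier, so that equality of elements of this set is equality of functions on the group.\<close>

definition hom_quasimorphisms :: "('a, 'b) monoid_scheme \<Rightarrow> ('a \<Rightarrow> real) set" where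
  "hom_quasimorphisms G =
     {\<mu> \<in> extensional (carrier G). quasimorphism G \<mu> \<and> homogeneous G \<mu>}"

definition nonzero_hom_quasimorphisms :: "('a, 'b) monoid_scheme \<Rightarrow> ('a \<Rightarrow> real) set" where
  "nonzero_hom_quasimorphisms G =
     {\<mu> \<in> hom_quasimorphisms G. \<exists>g\<in>carrier G. \<mu> g \<noteq> 0}"

definition lin_independent2 ::
  "('a, 'b) monoid_scheme \<Rightarrow> ('a \<Rightarrow> real) \<Rightarrow> ('a \<Rightarrow> real) \<Rightarrow> bool" where
  "lin_independent2 G \<mu> m \<longleftrightarrow>
     (\<forall>a b. (\<forall>g\<in>carrier G. a * \<mu> g + b * m g = 0) \<longrightarrow> a = 0 \<and> b = 0)"

definition proportional ::
  "('a, 'b) monoid_scheme \<Rightarrow> (('a \<Rightarrow> real) \<times> ('a \<Rightarrow> real)) set" where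
  "proportional G =
     {(\<mu>, m). \<mu> \<in> nonzero_hom_quasimorphisms G \<and> m \<in> nonzero_hom_quasimorphisms G \<and>
               (\<exists>c. c \<noteq> 0 \<and> (\<forall>g\<in>carrier G. m g = c * \<mu> g))}"

lemma equiv_proportional: "equiv (nonzero_hom_quasimorphisms G) (proportional G)"
proof (rule equivI)
  show "proportional G \<subseteq> nonzero_hom_quasimorphisms G \<times> nonzero_hom_quasimorphisms G"
    by (auto simp: proportional_def)
  show "refl_on (nonzero_hom_quasimorphisms G) (proportional G)"
    by (auto simp: refl_on_def proportional_def intro!: exI[of _ 1])
  show "sym (proportional G)"
  proof (rule symI)
    fix \<mu> m assume *: "(\<mu>, m) \<in> proportional G"
    then obtain c where "c \<noteq> 0" "\<forall>g\<in>carrier G. m g = c * \<mu> g"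
      by (auto simp: proportional_def)
    then have "1 / c \<noteq> 0" "\<forall>g\<in>carrier G. \<mu> g = (1 / c) * m g" by auto
    with * show "(m, \<mu>) \<in> proportional G" unfolding proportional_def by blast
  qed
  show "trans (proportional G)"
  proof (rule transI)
    fix \<mu> m k assume *: "(\<mu>, m) \<in> proportional G" "(m, k) \<in> proportional G"
    then obtain c d where "c \<noteq> 0" "\<forall>g\<in>carrier G. m g = c * \<mu> g"
        "d \<noteq> 0" "\<forall>g\<in>carrier G. k g = d * m g"
      by (auto simp: proportional_def)
    then have "d * c \<noteq> 0" "\<forall>g\<in>carrier G. k g = (d * c) * \<mu> g" by auto
    with * show "(\<mu>, k) \<in> proportional G" unfolding proportional_def by blast
  qed
qed

definition projective_hom_quasimorphisms :: "('a, 'b) monoid_scheme \<Rightarrow> ('a \<Rightarrow> real) set set" where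
  "projective_hom_quasimorphisms G = nonzero_hom_quasimorphisms G // proportional G"


section \<open>The space on which the groups act\<close>

definition lattice_space :: "real set \<Rightarrow> (real \<times> int) set" where
  "lattice_space H = H \<times> UNIV"

text \<open>The sum metric; the metric that the library puts on products is the Euclidean one.\<close>

definition lattice_dist :: "real \<times> int \<Rightarrow> real \<times> int \<Rightarrow> real" where
  "lattice_dist x y = \<bar>fst x - fst y\<bar> + of_int \<bar>snd x - snd y\<bar>"

definition height :: "real \<times> int \<Rightarrow> int" where
  "height = snd"

definition quasi_isometry :: "'x set \<Rightarrow> ('x \<Rightarrow> 'x \<Rightarrow> real) \<Rightarrow> ('x \<Rightarrow> 'x) \<Rightarrow> bool" where
  "quasi_isometry X d f \<longleftrightarrow> f \<in> X \<rightarrow> X \<and>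
     (\<exists>K\<ge>1. \<exists>C\<ge>0.
        (\<forall>x\<in>X. \<forall>y\<in>X. d x y / K - C \<le> d (f x) (f y) \<and> d (f x) (f y) \<le> K * d x y + C) \<and>
        (\<forall>y\<in>X. \<exists>x\<in>X. d (f x) y \<le> C))"

text \<open>Actual maps, not classes of maps at bounded distance.\<close>

definition QIh :: "real set \<Rightarrow> (real \<times> int \<Rightarrow> real \<times> int) set" where
  "QIh H = {f \<in> extensional (lattice_space H).
     quasi_isometry (lattice_space H) lattice_dist f \<and>
     (\<exists>B. \<forall>x\<in>lattice_space H. \<forall>y\<in>lattice_space H.
        \<bar>(height (f x) - height (f y)) - (height x - height y)\<bar> \<le> B)}"


section \<open>Representations and their equivalence\<close>

definition representations ::
  "('a, 'b) monoid_scheme \<Rightarrow> real set \<Rightarrow> ('a \<Rightarrow> real \<times> int \<Rightarrow> real \<times> int) set" where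
  "representations G H = {\<Psi> \<in> carrier G \<rightarrow>\<^sub>E QIh H. group_action G (lattice_space H) \<Psi>}"

definition rep_equiv ::
  "('a, 'b) monoid_scheme \<Rightarrow> real set \<Rightarrow>
     (('a \<Rightarrow> real \<times> int \<Rightarrow> real \<times> int) \<times> ('a \<Rightarrow> real \<times> int \<Rightarrow> real \<times> int)) set" where
  "rep_equiv G H = {(\<Psi>, \<Phi>). \<Psi> \<in> representations G H \<and> \<Phi> \<in> representations G H \<and>
     (\<exists>B. \<forall>g\<in>carrier G. \<forall>x\<in>lattice_space H. \<bar>height (\<Psi> g x) - height (\<Phi> g x)\<bar> \<le> B)}"

lemma equiv_rep_equiv: "equiv (representations G H) (rep_equiv G H)"
proof (rule equivI)
  show "rep_equiv G H \<subseteq> representations G H \<times> representations G H"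
    by (auto simp: rep_equiv_def)
  show "refl_on (representations G H) (rep_equiv G H)"
    by (auto simp: refl_on_def rep_equiv_def)
  show "sym (rep_equiv G H)"
    by (auto simp: sym_def rep_equiv_def abs_minus_commute)
  show "trans (rep_equiv G H)"
  proof (rule transI)
    fix \<Psi> \<Phi> \<Theta> assume *: "(\<Psi>, \<Phi>) \<in> rep_equiv G H" "(\<Phi>, \<Theta>) \<in> rep_equiv G H"
    then obtain B C where
      B: "\<forall>g\<in>carrier G. \<forall>x\<in>lattice_space H. \<bar>height (\<Psi> g x) - height (\<Phi> g x)\<bar> \<le> B" and
      C: "\<forall>g\<in>carrier G. \<forall>x\<in>lattice_space H. \<bar>height (\<Phi> g x) - height (\<Theta> g x)\<bar> \<le> C"
      by (auto simp: rep_equiv_def)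
    have "\<bar>height (\<Psi> g x) - height (\<Theta> g x)\<bar> \<le> B + C"
      if "g \<in> carrier G" "x \<in> lattice_space H" for g x
      using B[rule_format, OF that] C[rule_format, OF that] by linarith
    with * show "(\<Psi>, \<Theta>) \<in> rep_equiv G H" unfolding rep_equiv_def by blast
  qed
qed


section \<open>The representations induced by a quasimorphism\<close>

definition admissible_lift ::
  "('a, 'b) monoid_scheme \<Rightarrow> ('a \<Rightarrow> real) \<Rightarrow> ('a \<Rightarrow> int) \<Rightarrow> bool" where
  "admissible_lift G \<mu> \<mu>0 \<longleftrightarrow>
     quasimorphism G (\<lambda>g. of_int (\<mu>0 g)) \<and>
     homogenization_of G (\<lambda>g. of_int (\<mu>0 g)) \<mu> \<and>
     \<mu>0 \<one>\<^bsub>G\<^esub> = 0 \<and>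
     (\<forall>n. infinite {g \<in> carrier G. \<mu>0 g = n})"

definition fibrewise_identification ::
  "('a, 'b) monoid_scheme \<Rightarrow> real set \<Rightarrow> ('a \<Rightarrow> int) \<Rightarrow> ('a \<Rightarrow> real \<times> int) \<Rightarrow> bool" where
  "fibrewise_identification G H \<mu>0 \<beta> \<longleftrightarrow>
     (\<forall>n. bij_betw \<beta> {g \<in> carrier G. \<mu>0 g = n} (H \<times> {n}))"

definition transported_action ::
  "('a, 'b) monoid_scheme \<Rightarrow> real set \<Rightarrow> ('a \<Rightarrow> real \<times> int) \<Rightarrow>
     'a \<Rightarrow> real \<times> int \<Rightarrow> real \<times> int" where
  "transported_action G H \<beta> =
     (\<lambda>g\<in>carrier G. \<lambda>p\<in>lattice_space H. \<beta> (g \<otimes>\<^bsub>G\<^esub> inv_into (carrier G) \<beta> p))"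

definition directly_induced ::
  "('a, 'b) monoid_scheme \<Rightarrow> real set \<Rightarrow> ('a \<Rightarrow> real) \<Rightarrow>
     ('a \<Rightarrow> real \<times> int \<Rightarrow> real \<times> int) \<Rightarrow> bool" where
  "directly_induced G H \<mu> \<Psi> \<longleftrightarrow>
     (\<exists>\<mu>0 \<beta>. admissible_lift G \<mu> \<mu>0 \<and> fibrewise_identification G H \<mu>0 \<beta> \<and>
             \<Psi> = transported_action G H \<beta>)"

text \<open>That the fibres of the integer-valued quasimorphism may be taken infinite is a
  ``without loss of generality'' that can fail in \<open>G\<close> itself: for \<open>G = \<int>\<close> every
  quasimorphism with nonzero homogenization has finite fibres.  Only when \<open>G\<close> admits no
  \<open>\<mu>0\<close> with infinite fibres, the reduction is made explicit: \<open>G\<close> is replaced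
  by \<open>G \<times> \<int>\<close>, with \<open>\<mu>\<close> pulled back along the projection, and the resulting action is
  restricted to \<open>G \<times> {0}\<close>.\<close>

definition induced_representation ::
  "('a, 'b) monoid_scheme \<Rightarrow> real set \<Rightarrow> ('a \<Rightarrow> real) \<Rightarrow>
     ('a \<Rightarrow> real \<times> int \<Rightarrow> real \<times> int) \<Rightarrow> bool" where
  "induced_representation G H \<mu> \<Psi> \<longleftrightarrow>
     (if \<exists>\<mu>0. admissible_lift G \<mu> \<mu>0 then directly_induced G H \<mu> \<Psi>
      else (\<exists>\<Psi>'. directly_induced (G \<times>\<times> integer_group) H (\<lambda>p. \<mu> (fst p)) \<Psi>' \<and>
                  \<Psi> = (\<lambda>g\<in>carrier G. \<Psi>' (g, 0))))"

end

theory Submission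
  imports Defs
begin

text \<open>
  In an action induced by a homogeneous quasimorphism \<open>\<mu>\<close>, an element \<open>g\<close> moves the height of every
  point by \<open>\<mu> g\<close> up to a bounded error: the point identified with \<open>x\<close> has height \<open>\<mu>0 x\<close>, its image
  has height \<open>\<mu>0 (g x)\<close>, which is \<open>\<mu>0 g + \<mu>0 x\<close> up to the defect of \<open>\<mu>0\<close>, and \<open>\<mu>0\<close> is at bounded
  distance from its homogenization \<open>\<mu>\<close>.  Call this being a quasi-translation by \<open>\<mu>\<close>
  (\<open>quasi_translates\<close>).  Everything follows from it.

  A bijection of the lattice that changes height differences by a bounded amount is automatically a
  quasi-isometry, because the lattice has horizontal diameter at most 1; so the action is by
  elements of \<open>QIh H\<close>.  It is injective because left multiplication is free.

  Two quasi-translation actions, by \<open>\<mu>\<close> and by \<open>m\<close>, are equivalent if and only if \<open>\<mu> - m\<close> is bounded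
  (\<open>rep_equiv_iff_bounded_distance\<close>), and homogeneous quasimorphisms at bounded distance are equal.
  So the class of the induced action depends on nothing but \<open>\<mu>\<close>, and it determines \<open>\<mu>\<close>.  The map on the
  projective space picks one quasimorphism on each line and sends the line to the class of the
  action induced by it; distinct lines have distinct representatives.

  Existence needs an integer-valued function near \<open>\<mu>\<close> with infinite fibres.  If \<open>G\<close> has none, then
  \<open>G \<times> \<int>\<close> has one, namely \<open>(g, k) \<mapsto> \<lfloor>\<mu> g\<rfloor> + k mod M\<close>: the values of \<open>\<mu>\<close> along the powers of one
  element with \<open>\<mu> \<noteq> 0\<close> form an arithmetic progression, and when \<open>M\<close> exceeds its step the second
  summand fills the gaps, each residue being taken by infinitely many \<open>k\<close>
  (\<open>admissible_lift_times_integers\<close>).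
\<close>

section \<open>Quasimorphisms at bounded distance\<close>

lemma quasimorphism_nat_pow:
  assumes "group G" "g \<in> carrier G"
    and B: "\<And>x y. x \<in> carrier G \<Longrightarrow> y \<in> carrier G \<Longrightarrow> \<bar>\<mu> (x \<otimes>\<^bsub>G\<^esub> y) - \<mu> x - \<mu> y\<bar> \<le> B"
  shows "\<bar>\<mu> (g [^]\<^bsub>G\<^esub> Suc n) - real (Suc n) * \<mu> g\<bar> \<le> real n * B"
proof -
  interpret group G by fact
  show ?thesis
  proof (induction n)
    case 0
    then show ?case using assms(2) by simp
  next
    case (Suc n)
    have "\<bar>\<mu> (g [^]\<^bsub>G\<^esub> Suc (Suc n)) - \<mu> (g [^]\<^bsub>G\<^esub> Suc n) - \<mu> g\<bar> \<le> B"
      unfolding nat_pow_Suc[of g "Suc n"] by (intro B nat_pow_closed assms(2))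
    with Suc.IH show ?case by (simp add: algebra_simps del: nat_pow_Suc)
  qed
qed

text \<open>Dividing the estimate for powers by the exponent bounds the averages \<open>\<nu> (g\<^sup>n) / n\<close> within the
  defect of \<open>\<nu>\<close> from \<open>\<nu> g\<close>, uniformly in \<open>n\<close> and \<open>g\<close>, so the bound survives in the limit.\<close>

lemma homogenization_at_bounded_distance:
  assumes "group G" "quasimorphism G \<nu>" "homogenization_of G \<nu> \<mu>"
  shows "\<exists>B. \<forall>g\<in>carrier G. \<bar>\<nu> g - \<mu> g\<bar> \<le> B"
proof -
  obtain B where B: "\<And>x y. x \<in> carrier G \<Longrightarrow> y \<in> carrier G \<Longrightarrow>
      \<bar>\<nu> (x \<otimes>\<^bsub>G\<^esub> y) - \<nu> x - \<nu> y\<bar> \<le> B"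
    using assms(2) unfolding quasimorphism_def by blast
  have "\<bar>\<nu> g - \<mu> g\<bar> \<le> B" if g: "g \<in> carrier G" for g
  proof -
    have B0: "0 \<le> B" using B[OF g g] by linarith
    have "(\<lambda>n. \<nu> (g [^]\<^bsub>G\<^esub> n) / real n) \<longlonglongrightarrow> \<mu> g"
      using assms(3) g unfolding homogenization_of_def by blast
    then have "(\<lambda>n. \<nu> (g [^]\<^bsub>G\<^esub> Suc n) / real (Suc n)) \<longlonglongrightarrow> \<mu> g"
      by (rule LIMSEQ_Suc)
    then have lim: "(\<lambda>n. \<bar>\<nu> g - \<nu> (g [^]\<^bsub>G\<^esub> Suc n) / real (Suc n)\<bar>) \<longlonglongrightarrow> \<bar>\<nu> g - \<mu> g\<bar>"
      by (intro tendsto_intros)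
    have "\<bar>\<nu> g - \<nu> (g [^]\<^bsub>G\<^esub> Suc n) / real (Suc n)\<bar> \<le> B" for n
    proof -
      define s where "s = real (Suc n)"
      have s: "0 < s" "real n \<le> s" by (simp_all add: s_def)
      have "\<nu> g - \<nu> (g [^]\<^bsub>G\<^esub> Suc n) / s = - (\<nu> (g [^]\<^bsub>G\<^esub> Suc n) - s * \<nu> g) / s"
        using s(1) by (simp add: field_simps del: nat_pow_Suc)
      then have "\<bar>\<nu> g - \<nu> (g [^]\<^bsub>G\<^esub> Suc n) / s\<bar> = \<bar>\<nu> (g [^]\<^bsub>G\<^esub> Suc n) - s * \<nu> g\<bar> / s"
        using s(1) by (simp only: abs_divide abs_minus_cancel abs_of_pos)
      also have "\<dots> \<le> (real n * B) / s"
        using quasimorphism_nat_pow[OF assms(1) g B, of n] s(1)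
        by (intro divide_right_mono) (simp_all only: s_def less_imp_le)
      also have "\<dots> \<le> B"
        using s B0 mult_right_mono[OF s(2) B0] by (simp add: pos_divide_le_eq mult.commute)
      finally show ?thesis unfolding s_def .
    qed
    then show ?thesis by (intro LIMSEQ_le_const2[OF lim]) auto
  qed
  then show ?thesis by blast
qed

lemma homogeneous_nat_pow:
  assumes "homogeneous G \<mu>" "g \<in> carrier G"
  shows "\<mu> (g [^]\<^bsub>G\<^esub> (n::nat)) = real n * \<mu> g"
proof -
  have "\<mu> (g [^]\<^bsub>G\<^esub> int n) = of_int (int n) * \<mu> g"
    using assms unfolding homogeneous_def by blast
  then show ?thesis by (simp add: int_pow_int)
qed

text \<open>The difference is again homogeneous, so a nonzero value would grow linearly along powers.\<close>

lemma homogeneous_eq_if_bounded_distance: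
  assumes "group G" "homogeneous G \<mu>" "homogeneous G m"
    and B: "\<And>g. g \<in> carrier G \<Longrightarrow> \<bar>\<mu> g - m g\<bar> \<le> B" and g: "g \<in> carrier G"
  shows "\<mu> g = m g"
proof (rule ccontr)
  interpret group G by fact
  assume "\<mu> g \<noteq> m g"
  then obtain n where "B < real n * \<bar>\<mu> g - m g\<bar>"
    using reals_Archimedean3[of "\<bar>\<mu> g - m g\<bar>"] by auto
  also have "\<dots> = \<bar>\<mu> (g [^]\<^bsub>G\<^esub> n) - m (g [^]\<^bsub>G\<^esub> n)\<bar>"
    by (simp add: homogeneous_nat_pow[OF assms(2) g] homogeneous_nat_pow[OF assms(3) g]
          abs_mult flip: right_diff_distrib)
  also have "\<dots> \<le> B" by (intro B nat_pow_closed g)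
  finally show False by simp
qed

lemma quasimorphism_if_bounded_distance:
  assumes "group G" "quasimorphism G \<mu>" and C: "\<And>g. g \<in> carrier G \<Longrightarrow> \<bar>\<nu> g - \<mu> g\<bar> \<le> C"
  shows "quasimorphism G \<nu>"
proof -
  interpret group G by fact
  obtain B where B: "\<And>x y. x \<in> carrier G \<Longrightarrow> y \<in> carrier G \<Longrightarrow>
      \<bar>\<mu> (x \<otimes>\<^bsub>G\<^esub> y) - \<mu> x - \<mu> y\<bar> \<le> B"
    using assms(2) unfolding quasimorphism_def by blast
  have "\<bar>\<nu> (x \<otimes>\<^bsub>G\<^esub> y) - \<nu> x - \<nu> y\<bar> \<le> B + 3 * C" if "x \<in> carrier G" "y \<in> carrier G" for x y
    using B[OF that] C[OF that(1)] C[OF that(2)] C[OF m_closed[OF that]] by linarith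
  then show ?thesis unfolding quasimorphism_def by blast
qed

lemma homogenization_if_bounded_distance:
  assumes "group G" "homogeneous G \<mu>" and C: "\<And>g. g \<in> carrier G \<Longrightarrow> \<bar>\<nu> g - \<mu> g\<bar> \<le> C"
  shows "homogenization_of G \<nu> \<mu>"
  unfolding homogenization_of_def
proof
  interpret group G by fact
  fix g assume g: "g \<in> carrier G"
  have "\<bar>\<nu> (g [^]\<^bsub>G\<^esub> n) / real n - \<mu> g\<bar> \<le> C / real n" if "0 < n" for n
  proof -
    have "\<nu> (g [^]\<^bsub>G\<^esub> n) / real n - \<mu> g = (\<nu> (g [^]\<^bsub>G\<^esub> n) - \<mu> (g [^]\<^bsub>G\<^esub> n)) / real n"
      using that by (simp add: homogeneous_nat_pow[OF assms(2) g] field_simps)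
    then show ?thesis using C[OF nat_pow_closed[OF g, of n]] by (simp add: divide_right_mono)
  qed
  then have "eventually (\<lambda>n. norm (\<nu> (g [^]\<^bsub>G\<^esub> n) / real n - \<mu> g) \<le> C / real n) sequentially"
    by (auto intro: eventually_sequentiallyI[of 1])
  moreover have "(\<lambda>n. C / real n) \<longlonglongrightarrow> 0" by (rule lim_const_over_n)
  ultimately have "(\<lambda>n. \<nu> (g [^]\<^bsub>G\<^esub> n) / real n - \<mu> g) \<longlonglongrightarrow> 0" by (rule Lim_null_comparison)
  then show "(\<lambda>n. \<nu> (g [^]\<^bsub>G\<^esub> n) / real n) \<longlonglongrightarrow> \<mu> g" by (rule LIM_zero_cancel)
qed

lemma quasimorphism_pullback:
  assumes "group_hom G K f" "quasimorphism K \<mu>"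
  shows "quasimorphism G (\<lambda>x. \<mu> (f x))"
proof -
  interpret group_hom G K f by fact
  show ?thesis
    using assms(2) unfolding quasimorphism_def by (simp add: hom_closed) (meson hom_closed)
qed

lemma homogeneous_pullback:
  assumes "group_hom G K f" "homogeneous K \<mu>"
  shows "homogeneous G (\<lambda>x. \<mu> (f x))"
proof -
  interpret group_hom G K f by fact
  show ?thesis using assms(2) unfolding homogeneous_def by (simp add: hom_int_pow)
qed

section \<open>Lifts to the integers with infinite fibres\<close>

text \<open>The second factor serves twice: its residue modulo \<open>M\<close> makes the lift surjective although the
  values of \<open>\<mu>\<close> may have gaps, and adding multiples of \<open>M\<close> to it makes every fibre infinite.\<close>

lemma admissible_lift_times_integers:
  assumes "group G" "\<mu> \<in> nonzero_hom_quasimorphisms G"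
  shows "\<exists>\<mu>0. admissible_lift (G \<times>\<times> integer_group) (\<lambda>p. \<mu> (fst p)) \<mu>0"
proof -
  interpret group G by fact
  let ?P = "G \<times>\<times> integer_group"
  have P: "group ?P" by (intro DirProd_group assms(1) group_integer_group)
  have fst: "group_hom ?P G fst"
    by (intro group_hom.intro group_hom_axioms.intro P assms(1)) (auto simp: hom_def DirProd_def)
  have qm: "quasimorphism G \<mu>" and hom: "homogeneous G \<mu>"
    using assms(2) by (auto simp: nonzero_hom_quasimorphisms_def hom_quasimorphisms_def)
  obtain g where g: "g \<in> carrier G" and g0: "\<mu> g \<noteq> 0"
    using assms(2) by (auto simp: nonzero_hom_quasimorphisms_def)
  \<comment> \<open>One more than the step \<open>\<bar>\<mu> g\<bar>\<close> of the progression, because taking the floor can widen a gap.\<close>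
  define M where "M = \<lceil>\<bar>\<mu> g\<bar>\<rceil> + 1"
  have M: "0 < M" "\<bar>\<mu> g\<bar> + 1 \<le> of_int M"
    unfolding M_def by linarith+
  define \<mu>0 where "\<mu>0 = (\<lambda>(x, k). \<lfloor>\<mu> x\<rfloor> + k mod M)"
  have near: "\<bar>of_int (\<mu>0 p) - \<mu> (fst p)\<bar> \<le> of_int M + 1" for p
  proof -
    have "0 \<le> snd p mod M" "snd p mod M < M" using M(1) by simp_all
    then show ?thesis unfolding \<mu>0_def by (simp add: case_prod_beta) linarith
  qed
  have "\<mu> \<one>\<^bsub>G\<^esub> = 0"
    using homogeneous_nat_pow[OF hom one_closed, of 0] by simp
  then have one: "\<mu>0 \<one>\<^bsub>?P\<^esub> = 0" by (simp add: \<mu>0_def DirProd_def)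
  have "infinite {p \<in> carrier ?P. \<mu>0 p = n}" for n
  proof -
    obtain x where x: "x \<in> carrier G" "0 \<le> n - \<lfloor>\<mu> x\<rfloor>" "n - \<lfloor>\<mu> x\<rfloor> < M"
    proof
      \<comment> \<open>\<open>j * \<mu> g\<close> is to be the largest multiple of \<open>\<mu> g\<close> that is at most \<open>n\<close>; dividing by a negative
        \<open>\<mu> g\<close> reverses the order, hence the ceiling.\<close>
      define j where "j = (if 0 < \<mu> g then \<lfloor>of_int n / \<mu> g\<rfloor> else \<lceil>of_int n / \<mu> g\<rceil>)"
      have *: "of_int j * \<mu> g \<le> of_int n" "of_int n - of_int j * \<mu> g < \<bar>\<mu> g\<bar>"
      proof -
        show "of_int j * \<mu> g \<le> of_int n"
        proof (cases "0 < \<mu> g")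
          case True
          then show ?thesis by (simp add: j_def flip: pos_le_divide_eq)
        next
          case False
          then show ?thesis using g0 by (simp add: j_def flip: neg_divide_le_eq)
        qed
        show "of_int n - of_int j * \<mu> g < \<bar>\<mu> g\<bar>"
        proof (cases "0 < \<mu> g")
          case True
          have "of_int n / \<mu> g < of_int j + 1" using True unfolding j_def by simp
          then show ?thesis using True by (simp add: field_simps)
        next
          case False
          have "of_int j - 1 < of_int n / \<mu> g" using False unfolding j_def by simp linarith
          then show ?thesis using False g0 by (simp add: field_simps)
        qed
      qed
      have \<mu>j: "\<mu> (g [^]\<^bsub>G\<^esub> j) = of_int j * \<mu> g"
        using hom g unfolding homogeneous_def by blast
      show "g [^]\<^bsub>G\<^esub> j \<in> carrier G" using g by (rule int_pow_closed)
      show "0 \<le> n - \<lfloor>\<mu> (g [^]\<^bsub>G\<^esub> j)\<rfloor>" unfolding \<mu>j using * by linarith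
      show "n - \<lfloor>\<mu> (g [^]\<^bsub>G\<^esub> j)\<rfloor> < M" unfolding \<mu>j using * M by linarith
    qed
    define f where "f = (\<lambda>i::int. (x, n - \<lfloor>\<mu> x\<rfloor> + i * M))"
    have "range f \<subseteq> {p \<in> carrier ?P. \<mu>0 p = n}"
      using x by (auto simp: f_def \<mu>0_def DirProd_def)
    moreover have "inj f" using M(1) by (auto simp: f_def inj_on_def)
    then have "infinite (range f)" by (simp add: finite_image_iff infinite_UNIV_int)
    ultimately show ?thesis using finite_subset by blast
  qed
  moreover have "quasimorphism ?P (\<lambda>p. of_int (\<mu>0 p))"
    using quasimorphism_if_bounded_distance[OF P quasimorphism_pullback[OF fst qm] near] .
  moreover have "homogenization_of ?P (\<lambda>p. of_int (\<mu>0 p)) (\<lambda>p. \<mu> (fst p))"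
    using homogenization_if_bounded_distance[OF P homogeneous_pullback[OF fst hom] near] .
  ultimately have "admissible_lift ?P (\<lambda>p. \<mu> (fst p)) \<mu>0"
    using one by (simp add: admissible_lift_def)
  then show ?thesis by blast
qed

lemma fibrewise_identification_exists:
  assumes "countable (carrier G)" "countable H" "infinite H"
    and "\<And>n. infinite {g \<in> carrier G. \<mu>0 g = n}"
  shows "\<exists>\<beta>. fibrewise_identification G H \<mu>0 \<beta>"
proof -
  have "\<exists>b. bij_betw b {g \<in> carrier G. \<mu>0 g = n} (H \<times> {n})" for n
  proof -
    let ?F = "{g \<in> carrier G. \<mu>0 g = n}"
    have "countable ?F" by (rule countable_subset[OF _ assms(1)]) auto
    then have "bij_betw (to_nat_on ?F) ?F UNIV"
      using assms(4) by (rule to_nat_on_infinite)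
    moreover have "infinite (H \<times> {n})" using assms(3) by (auto dest: finite_cartesian_productD1)
    then have "bij_betw (from_nat_into (H \<times> {n})) UNIV (H \<times> {n})"
      using assms(2) by (intro bij_betw_from_nat_into) auto
    ultimately show ?thesis by (blast intro: bij_betw_trans)
  qed
  then obtain b where b: "\<And>n. bij_betw (b n) {g \<in> carrier G. \<mu>0 g = n} (H \<times> {n})" by metis
  have "bij_betw (\<lambda>g. b (\<mu>0 g) g) {g \<in> carrier G. \<mu>0 g = n} (H \<times> {n})" for n
    using b[of n] by (rule bij_betw_cong[THEN iffD1, rotated]) auto
  then show ?thesis unfolding fibrewise_identification_def by blast
qed

section \<open>Actions that translate heights up to a bounded error\<close>

definition quasi_translates ::
  "('a, 'b) monoid_scheme \<Rightarrow> real set \<Rightarrow> ('a \<Rightarrow> real) \<Rightarrow>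
     ('a \<Rightarrow> real \<times> int \<Rightarrow> real \<times> int) \<Rightarrow> bool" where
  "quasi_translates G H \<mu> \<Psi> \<longleftrightarrow>
     (\<exists>B. \<forall>g\<in>carrier G. \<forall>x\<in>lattice_space H.
        \<bar>of_int (height (\<Psi> g x)) - of_int (height x) - \<mu> g\<bar> \<le> B)"

text \<open>Since \<open>H\<close> lies in the unit interval, the distance of two points of the lattice is the
  difference of their heights up to an error of 1.\<close>

lemma QIh_if_height_differences_bounded:
  assumes "H \<subseteq> {0<..<1}" and f: "f \<in> Bij (lattice_space H)"
    and B: "\<And>x y. x \<in> lattice_space H \<Longrightarrow> y \<in> lattice_space H \<Longrightarrow>
      \<bar>(height (f x) - height (f y)) - (height x - height y)\<bar> \<le> B"
  shows "f \<in> QIh H"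
proof -
  let ?L = "lattice_space H"
  have ext: "f \<in> extensional ?L" and bij: "bij_betw f ?L ?L"
    using f by (auto simp: Bij_def)
  have maps: "f x \<in> ?L" if "x \<in> ?L" for x using bij that by (rule bij_betwE[rule_format])
  have dist: "of_int \<bar>height x - height y\<bar> \<le> lattice_dist x y"
    "lattice_dist x y \<le> of_int \<bar>height x - height y\<bar> + 1" if "x \<in> ?L" "y \<in> ?L" for x y
  proof -
    have "fst x \<in> {0<..<1}" "fst y \<in> {0<..<1}" using that assms(1) by (auto simp: lattice_space_def)
    then have "\<bar>fst x - fst y\<bar> \<le> 1" by auto
    then show "of_int \<bar>height x - height y\<bar> \<le> lattice_dist x y"
      "lattice_dist x y \<le> of_int \<bar>height x - height y\<bar> + 1"
      by (simp_all add: lattice_dist_def height_def)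
  qed
  define C :: real where "C = of_int (max 0 B) + 1"
  have C: "0 \<le> C" by (simp add: C_def)
  have "lattice_dist x y / 1 - C \<le> lattice_dist (f x) (f y)
      \<and> lattice_dist (f x) (f y) \<le> 1 * lattice_dist x y + C" if xy: "x \<in> ?L" "y \<in> ?L" for x y
  proof -
    have "\<bar>\<bar>height (f x) - height (f y)\<bar> - \<bar>height x - height y\<bar>\<bar> \<le> max 0 B"
      using B[OF xy] by linarith
    then have "\<bar>real_of_int \<bar>height (f x) - height (f y)\<bar> - real_of_int \<bar>height x - height y\<bar>\<bar>
        \<le> real_of_int (max 0 B)"
      by linarith
    then show ?thesis
      using dist[OF xy] dist[OF maps[OF xy(1)] maps[OF xy(2)]] unfolding C_def by linarith
  qed
  moreover have "\<exists>x\<in>?L. lattice_dist (f x) y \<le> C" if "y \<in> ?L" for y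
  proof -
    have "y \<in> f ` ?L" using bij_betw_imp_surj_on[OF bij] that by simp
    then obtain x where "x \<in> ?L" "y = f x" by (rule imageE)
    moreover have "lattice_dist y y = 0" by (simp add: lattice_dist_def)
    ultimately show ?thesis using C by (intro bexI[of _ x]) simp_all
  qed
  ultimately have "quasi_isometry ?L lattice_dist f"
    unfolding quasi_isometry_def using maps C by (intro conjI exI[of _ 1] exI[of _ C]) auto
  moreover have "\<exists>B. \<forall>x\<in>?L. \<forall>y\<in>?L.
      \<bar>(height (f x) - height (f y)) - (height x - height y)\<bar> \<le> B"
    by (intro exI ballI) (rule B)
  ultimately show ?thesis unfolding QIh_def using ext by simp
qed

lemma representation_if_quasi_translates:
  assumes "H \<subseteq> {0<..<1}" "group_action G (lattice_space H) \<Psi>" "\<Psi> \<in> extensional (carrier G)"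
    and "quasi_translates G H \<mu> \<Psi>"
  shows "\<Psi> \<in> representations G H"
proof -
  obtain B where B: "\<And>g x. g \<in> carrier G \<Longrightarrow> x \<in> lattice_space H \<Longrightarrow>
      \<bar>of_int (height (\<Psi> g x)) - of_int (height x) - \<mu> g\<bar> \<le> B"
    using assms(4) unfolding quasi_translates_def by blast
  have "\<Psi> g \<in> QIh H" if g: "g \<in> carrier G" for g
  proof (rule QIh_if_height_differences_bounded[OF assms(1)])
    show "\<Psi> g \<in> Bij (lattice_space H)"
      using assms(2) g by (rule group_action.bij_prop0)
    fix x y assume "x \<in> lattice_space H" "y \<in> lattice_space H"
    with B[OF g] have "\<bar>of_int (height (\<Psi> g x)) - of_int (height x) - \<mu> g\<bar> \<le> B"
      "\<bar>of_int (height (\<Psi> g y)) - of_int (height y) - \<mu> g\<bar> \<le> B" by blast+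
    then show "\<bar>(height (\<Psi> g x) - height (\<Psi> g y)) - (height x - height y)\<bar> \<le> \<lceil>2 * B\<rceil>"
      by linarith
  qed
  then show ?thesis using assms(2,3) by (auto simp: representations_def PiE_def)
qed

text \<open>The heights of \<open>\<Psi> g x\<close> and \<open>\<Phi> g x\<close> differ by \<open>\<mu> g - m g\<close> up to a bounded error; the height of
  \<open>x\<close> cancels.\<close>

lemma rep_equiv_iff_bounded_distance:
  assumes "\<Psi> \<in> representations G H" "\<Phi> \<in> representations G H" "H \<noteq> {}"
    and "quasi_translates G H \<mu> \<Psi>" "quasi_translates G H m \<Phi>"
  shows "(\<Psi>, \<Phi>) \<in> rep_equiv G H \<longleftrightarrow> (\<exists>B. \<forall>g\<in>carrier G. \<bar>\<mu> g - m g\<bar> \<le> B)"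
proof -
  obtain B where B: "\<And>g x. g \<in> carrier G \<Longrightarrow> x \<in> lattice_space H \<Longrightarrow>
      \<bar>of_int (height (\<Psi> g x)) - of_int (height x) - \<mu> g\<bar> \<le> B"
    using assms(4) unfolding quasi_translates_def by blast
  obtain C where C: "\<And>g x. g \<in> carrier G \<Longrightarrow> x \<in> lattice_space H \<Longrightarrow>
      \<bar>of_int (height (\<Phi> g x)) - of_int (height x) - m g\<bar> \<le> C"
    using assms(5) unfolding quasi_translates_def by blast
  show ?thesis
  proof
    assume "(\<Psi>, \<Phi>) \<in> rep_equiv G H"
    then obtain D where D: "\<And>g x. g \<in> carrier G \<Longrightarrow> x \<in> lattice_space H \<Longrightarrow>
        \<bar>height (\<Psi> g x) - height (\<Phi> g x)\<bar> \<le> D"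
      by (auto simp: rep_equiv_def)
    obtain x where x: "x \<in> lattice_space H" using assms(3) by (auto simp: lattice_space_def)
    have "\<bar>\<mu> g - m g\<bar> \<le> B + C + of_int D" if g: "g \<in> carrier G" for g
      using B[OF g x] C[OF g x] D[OF g x] by linarith
    then show "\<exists>B. \<forall>g\<in>carrier G. \<bar>\<mu> g - m g\<bar> \<le> B" by blast
  next
    assume "\<exists>B. \<forall>g\<in>carrier G. \<bar>\<mu> g - m g\<bar> \<le> B"
    then obtain D where D: "\<And>g. g \<in> carrier G \<Longrightarrow> \<bar>\<mu> g - m g\<bar> \<le> D" by blast
    have "\<bar>height (\<Psi> g x) - height (\<Phi> g x)\<bar> \<le> \<lceil>B + C + D\<rceil>"
      if "g \<in> carrier G" "x \<in> lattice_space H" for g x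
      using B[OF that] C[OF that] D[OF that(1)] by linarith
    then show "(\<Psi>, \<Phi>) \<in> rep_equiv G H"
      using assms(1,2) unfolding rep_equiv_def by blast
  qed
qed

lemma rep_equiv_class_eq_iff:
  assumes "\<Psi> \<in> representations G H" "\<Phi> \<in> representations G H"
  shows "rep_equiv G H `` {\<Psi>} = rep_equiv G H `` {\<Phi>} \<longleftrightarrow> (\<Psi>, \<Phi>) \<in> rep_equiv G H"
  using eq_equiv_class_iff[OF equiv_rep_equiv assms] .

section \<open>Induced representations\<close>

lemma group_action_transported_action:
  assumes "group G" and \<beta>: "bij_betw \<beta> (carrier G) (lattice_space H)"
  shows "group_action G (lattice_space H) (transported_action G H \<beta>)"
proof -
  interpret group G by fact
  let ?L = "lattice_space H" and ?\<Psi> = "transported_action G H \<beta>"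
  let ?\<gamma> = "inv_into (carrier G) \<beta>"
  have \<gamma>: "?\<gamma> p \<in> carrier G" "\<beta> (?\<gamma> p) = p" if "p \<in> ?L" for p
    using bij_betw_inv_into_right[OF \<beta> that] bij_betwE[OF bij_betw_inv_into[OF \<beta>]] that by auto
  have \<gamma>\<beta>: "?\<gamma> (\<beta> x) = x" if "x \<in> carrier G" for x
    using bij_betw_inv_into_left[OF \<beta> that] .
  have maps: "\<beta> x \<in> ?L" if "x \<in> carrier G" for x using bij_betwE[OF \<beta>] that by blast
  have bij: "?\<Psi> g \<in> Bij ?L" if g: "g \<in> carrier G" for g
  proof -
    have "bij_betw (?\<Psi> g) ?L ?L"
    proof (rule bij_betw_byWitness[where f' = "\<lambda>p. \<beta> (inv\<^bsub>G\<^esub> g \<otimes>\<^bsub>G\<^esub> ?\<gamma> p)"])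
      show "\<forall>p\<in>?L. \<beta> (inv\<^bsub>G\<^esub> g \<otimes>\<^bsub>G\<^esub> ?\<gamma> (?\<Psi> g p)) = p"
        using g \<gamma> by (simp add: transported_action_def \<gamma>\<beta> m_assoc[symmetric])
      show "\<forall>p\<in>?L. ?\<Psi> g (\<beta> (inv\<^bsub>G\<^esub> g \<otimes>\<^bsub>G\<^esub> ?\<gamma> p)) = p"
        using g \<gamma> by (simp add: transported_action_def \<gamma>\<beta> maps m_assoc[symmetric])
    qed (use g \<gamma> maps in \<open>auto simp: transported_action_def\<close>)
    then show ?thesis using g by (simp add: Bij_def transported_action_def)
  qed
  have "?\<Psi> (g \<otimes>\<^bsub>G\<^esub> k) = compose ?L (?\<Psi> g) (?\<Psi> k)" if "g \<in> carrier G" "k \<in> carrier G" for g k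
    using that \<gamma> by (auto simp: transported_action_def compose_def fun_eq_iff \<gamma>\<beta> maps m_assoc)
  then have "?\<Psi> \<in> hom G (BijGroup ?L)"
    using bij by (intro homI) (simp_all add: BijGroup_def)
  then show ?thesis
    by (intro group_action.intro group_hom.intro group_hom_axioms.intro group_BijGroup assms(1))
qed

lemma inj_on_transported_action:
  assumes "group G" and \<beta>: "bij_betw \<beta> (carrier G) (lattice_space H)"
  shows "inj_on (transported_action G H \<beta>) (carrier G)"
proof (rule inj_onI)
  interpret group G by fact
  fix g k assume gk: "g \<in> carrier G" "k \<in> carrier G"
    and eq: "transported_action G H \<beta> g = transported_action G H \<beta> k"
  \<comment> \<open>The image of the point \<open>\<beta> \<one>\<close> already tells the acting element.\<close>
  have "\<beta> \<one>\<^bsub>G\<^esub> \<in> lattice_space H" using bij_betwE[OF \<beta>] by blast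
  moreover have "inv_into (carrier G) \<beta> (\<beta> \<one>\<^bsub>G\<^esub>) = \<one>\<^bsub>G\<^esub>"
    by (rule bij_betw_inv_into_left[OF \<beta> one_closed])
  ultimately have "\<beta> g = \<beta> k"
    using fun_cong[OF eq, of "\<beta> \<one>\<^bsub>G\<^esub>"] gk by (simp add: transported_action_def)
  then show "g = k" using \<beta> gk by (auto simp: bij_betw_def inj_on_def)
qed

lemma fibrewise_identificationD:
  assumes "fibrewise_identification G H \<mu>0 \<beta>"
  shows "bij_betw \<beta> (carrier G) (lattice_space H)"
    and "x \<in> carrier G \<Longrightarrow> height (\<beta> x) = \<mu>0 x"
proof -
  have b: "bij_betw \<beta> {g \<in> carrier G. \<mu>0 g = n} (H \<times> {n})" for n
    using assms by (simp add: fibrewise_identification_def)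
  have ht: "height (\<beta> x) = \<mu>0 x" if "x \<in> carrier G" for x
    using bij_betwE[OF b[of "\<mu>0 x"]] that by (auto simp: height_def)
  then show "x \<in> carrier G \<Longrightarrow> height (\<beta> x) = \<mu>0 x" .
  have "inj_on \<beta> (carrier G)"
  proof (rule inj_onI)
    fix x y assume xy: "x \<in> carrier G" "y \<in> carrier G" "\<beta> x = \<beta> y"
    then have "\<mu>0 x = \<mu>0 y" by (metis ht)
    then show "x = y" using xy bij_betw_imp_inj_on[OF b[of "\<mu>0 y"]] by (auto dest: inj_onD)
  qed
  moreover have "\<beta> ` carrier G = (\<Union>n. \<beta> ` {g \<in> carrier G. \<mu>0 g = n})" by blast
  then have "\<beta> ` carrier G = lattice_space H"
    using bij_betw_imp_surj_on[OF b] by (auto simp: lattice_space_def)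
  ultimately show "bij_betw \<beta> (carrier G) (lattice_space H)" by (simp add: bij_betw_def)
qed

lemma directly_induced_properties:
  assumes "group G" "directly_induced G H \<mu> \<Psi>"
  shows "group_action G (lattice_space H) \<Psi>" "inj_on \<Psi> (carrier G)"
    "\<Psi> \<in> extensional (carrier G)" "quasi_translates G H \<mu> \<Psi>"
proof -
  interpret group G by fact
  obtain \<mu>0 \<beta> where lift: "admissible_lift G \<mu> \<mu>0" and ident: "fibrewise_identification G H \<mu>0 \<beta>"
    and \<Psi>: "\<Psi> = transported_action G H \<beta>"
    using assms(2) unfolding directly_induced_def by blast
  note \<beta> = fibrewise_identificationD[OF ident]
  show "group_action G (lattice_space H) \<Psi>"
    unfolding \<Psi> by (rule group_action_transported_action[OF assms(1) \<beta>(1)])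
  show "inj_on \<Psi> (carrier G)"
    unfolding \<Psi> by (rule inj_on_transported_action[OF assms(1) \<beta>(1)])
  show "\<Psi> \<in> extensional (carrier G)" by (simp add: \<Psi> transported_action_def)
  have qm: "quasimorphism G (\<lambda>g. of_int (\<mu>0 g))"
    and hl: "homogenization_of G (\<lambda>g. of_int (\<mu>0 g)) \<mu>"
    using lift by (auto simp: admissible_lift_def)
  obtain C where C: "\<And>g. g \<in> carrier G \<Longrightarrow> \<bar>of_int (\<mu>0 g) - \<mu> g\<bar> \<le> C"
    using homogenization_at_bounded_distance[OF assms(1) qm hl] by blast
  obtain B where B: "\<And>x y. x \<in> carrier G \<Longrightarrow> y \<in> carrier G \<Longrightarrow>
      \<bar>of_int (\<mu>0 (x \<otimes>\<^bsub>G\<^esub> y)) - of_int (\<mu>0 x) - of_int (\<mu>0 y)\<bar> \<le> (B::real)"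
    using qm unfolding quasimorphism_def by blast
  have "\<bar>of_int (height (\<Psi> g p)) - of_int (height p) - \<mu> g\<bar> \<le> B + C"
    if g: "g \<in> carrier G" and p: "p \<in> lattice_space H" for g p
  proof -
    have "p \<in> \<beta> ` carrier G" using p bij_betw_imp_surj_on[OF \<beta>(1)] by simp
    then obtain x where x: "x \<in> carrier G" "p = \<beta> x" by blast
    have "\<Psi> g p = \<beta> (g \<otimes>\<^bsub>G\<^esub> x)"
      using g p x bij_betw_inv_into_left[OF \<beta>(1) x(1)] by (simp add: \<Psi> transported_action_def)
    then have "height (\<Psi> g p) = \<mu>0 (g \<otimes>\<^bsub>G\<^esub> x)" "height p = \<mu>0 x"
      using g x by (simp_all add: \<beta>(2))
    then show ?thesis using B[OF g x(1)] C[OF g] by linarith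
  qed
  then show "quasi_translates G H \<mu> \<Psi>"
    unfolding quasi_translates_def by (intro exI[of _ "B + C"] ballI)
qed

lemma group_action_pullback:
  assumes "group_action K E \<Psi>" "group_hom G K f"
  shows "group_action G E (\<lambda>g\<in>carrier G. \<Psi> (f g))"
proof -
  have f: "f \<in> hom G K" and G: "group G"
    using assms(2) by (simp_all add: group_hom_def group_hom_axioms_def)
  have "\<Psi> \<in> hom K (BijGroup E)"
    using group_action.group_hom[OF assms(1)] by (simp add: group_hom_def group_hom_axioms_def)
  with f have "\<Psi> \<circ> f \<in> hom G (BijGroup E)" by (rule hom_compose)
  then have "(\<lambda>g\<in>carrier G. \<Psi> (f g)) \<in> hom G (BijGroup E)"
    by (rule group.hom_eq[OF G]) simp
  then show ?thesis
    by (intro group_action.intro group_hom.intro group_hom_axioms.intro group_BijGroup G)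
qed

lemma induced_representation_properties:
  assumes "group G" "H \<subseteq> {0<..<1}" "induced_representation G H \<mu> \<Psi>"
  shows "\<Psi> \<in> representations G H" "inj_on \<Psi> (carrier G)" "quasi_translates G H \<mu> \<Psi>"
proof -
  have "group_action G (lattice_space H) \<Psi> \<and> inj_on \<Psi> (carrier G) \<and>
      \<Psi> \<in> extensional (carrier G) \<and> quasi_translates G H \<mu> \<Psi>"
  proof (cases "\<exists>\<mu>0. admissible_lift G \<mu> \<mu>0")
    case True
    then have "directly_induced G H \<mu> \<Psi>" using assms(3) by (simp add: induced_representation_def)
    then show ?thesis using directly_induced_properties[OF assms(1)] by blast
  next
    case False
    let ?P = "G \<times>\<times> integer_group"
    have P: "group ?P" by (intro DirProd_group assms(1) group_integer_group)
    obtain \<Psi>' where \<Psi>': "directly_induced ?P H (\<lambda>p. \<mu> (fst p)) \<Psi>'"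
      and \<Psi>: "\<Psi> = (\<lambda>g\<in>carrier G. \<Psi>' (g, 0))"
      using False assms(3) by (auto simp: induced_representation_def)
    note props = directly_induced_properties[OF P \<Psi>']
    have "group_hom G ?P (\<lambda>g. (g, 0))"
      by (intro group_hom.intro group_hom_axioms.intro P assms(1)) (auto simp: hom_def DirProd_def)
    then have "group_action G (lattice_space H) \<Psi>"
      unfolding \<Psi> by (rule group_action_pullback[OF props(1)])
    moreover have "inj_on \<Psi> (carrier G)"
      using props(2) by (auto simp: \<Psi> inj_on_def DirProd_def)
    moreover have "quasi_translates G H \<mu> \<Psi>"
      using props(4) by (fastforce simp: \<Psi> quasi_translates_def DirProd_def)
    ultimately show ?thesis by (simp add: \<Psi>)
  qed
  then show "\<Psi> \<in> representations G H" "inj_on \<Psi> (carrier G)" "quasi_translates G H \<mu> \<Psi>"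
    using representation_if_quasi_translates[OF assms(2)] by auto
qed

lemma induced_representation_exists:
  assumes "group G" "countable (carrier G)" "countable H" "infinite H"
    and "\<mu> \<in> nonzero_hom_quasimorphisms G"
  shows "\<exists>\<Psi>. induced_representation G H \<mu> \<Psi>"
proof (cases "\<exists>\<mu>0. admissible_lift G \<mu> \<mu>0")
  case True
  then obtain \<mu>0 where lift: "admissible_lift G \<mu> \<mu>0" by blast
  then have "infinite {g \<in> carrier G. \<mu>0 g = n}" for n by (simp add: admissible_lift_def)
  then obtain \<beta> where "fibrewise_identification G H \<mu>0 \<beta>"
    using fibrewise_identification_exists[OF assms(2-4)] by blast
  with lift have "directly_induced G H \<mu> (transported_action G H \<beta>)"
    unfolding directly_induced_def by blast
  with True show ?thesis by (auto simp: induced_representation_def)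
next
  case False
  let ?P = "G \<times>\<times> integer_group"
  obtain \<mu>0 where lift: "admissible_lift ?P (\<lambda>p. \<mu> (fst p)) \<mu>0"
    using admissible_lift_times_integers[OF assms(1,5)] by blast
  then have "infinite {p \<in> carrier ?P. \<mu>0 p = n}" for n by (simp add: admissible_lift_def)
  moreover have "countable (carrier ?P)" using assms(2) by (simp add: DirProd_def)
  ultimately obtain \<beta> where "fibrewise_identification ?P H \<mu>0 \<beta>"
    using fibrewise_identification_exists[OF _ assms(3,4)] by blast
  with lift have "directly_induced ?P H (\<lambda>p. \<mu> (fst p)) (transported_action ?P H \<beta>)"
    unfolding directly_induced_def by blast
  with False show ?thesis by (auto simp: induced_representation_def)
qed

lemma induced_class_eq_iff:
  assumes "group G" "H \<subseteq> {0<..<1}" "H \<noteq> {}" "homogeneous G \<mu>" "homogeneous G m"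
    and "induced_representation G H \<mu> \<Psi>" "induced_representation G H m \<Phi>"
  shows "rep_equiv G H `` {\<Psi>} = rep_equiv G H `` {\<Phi>} \<longleftrightarrow> (\<forall>g\<in>carrier G. \<mu> g = m g)"
proof -
  note \<Psi> = induced_representation_properties[OF assms(1,2,6)]
  note \<Phi> = induced_representation_properties[OF assms(1,2,7)]
  have "(\<exists>B. \<forall>g\<in>carrier G. \<bar>\<mu> g - m g\<bar> \<le> B) \<longleftrightarrow> (\<forall>g\<in>carrier G. \<mu> g = m g)"
  proof
    assume "\<exists>B. \<forall>g\<in>carrier G. \<bar>\<mu> g - m g\<bar> \<le> B"
    then obtain B where B: "\<And>g. g \<in> carrier G \<Longrightarrow> \<bar>\<mu> g - m g\<bar> \<le> B" by blast
    show "\<forall>g\<in>carrier G. \<mu> g = m g"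
      using homogeneous_eq_if_bounded_distance[OF assms(1,4,5) B] by blast
  qed (intro exI[of _ 0], simp)
  then show ?thesis
    using rep_equiv_class_eq_iff[OF \<Psi>(1) \<Phi>(1)]
      rep_equiv_iff_bounded_distance[OF \<Psi>(1) \<Phi>(1) assms(3) \<Psi>(3) \<Phi>(3)] by simp
qed

section \<open>The projective space of homogeneous quasimorphisms\<close>

text \<open>Proportional quasimorphisms induce inequivalent actions unless they are equal, so the class
  is no function of the line alone: a representative of each line has to be chosen.  Since the class
  recovers that representative, it also recovers the line.\<close>

lemma projective_class_embedding:
  assumes "group G" "countable (carrier G)" "H \<subseteq> {0<..<1}" "countable H" "infinite H"
  shows "\<exists>\<iota>. inj_on \<iota> (projective_hom_quasimorphisms G) \<and>
      \<iota> ` projective_hom_quasimorphisms G \<subseteq> representations G H // rep_equiv G H \<and>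
      (\<forall>P\<in>projective_hom_quasimorphisms G. \<exists>\<mu>\<in>P. \<exists>\<Psi>.
         induced_representation G H \<mu> \<Psi> \<and> \<iota> P = rep_equiv G H `` {\<Psi>})"
proof -
  let ?N = "nonzero_hom_quasimorphisms G" and ?PP = "projective_hom_quasimorphisms G"
  have H0: "H \<noteq> {}" using assms(5) by auto
  have "\<exists>\<mu> \<Psi>. \<mu> \<in> P \<and> \<mu> \<in> ?N \<and> induced_representation G H \<mu> \<Psi>" if "P \<in> ?PP" for P
  proof -
    have "P \<noteq> {}" "P \<subseteq> ?N"
      using that in_quotient_imp_non_empty[OF equiv_proportional]
        in_quotient_imp_subset[OF equiv_proportional]
      unfolding projective_hom_quasimorphisms_def by blast+
    then show ?thesis using induced_representation_exists[OF assms(1,2,4,5)] by blast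
  qed
  then obtain rep \<Psi> where rep: "\<And>P. P \<in> ?PP \<Longrightarrow> rep P \<in> P" "\<And>P. P \<in> ?PP \<Longrightarrow> rep P \<in> ?N"
    and ind: "\<And>P. P \<in> ?PP \<Longrightarrow> induced_representation G H (rep P) (\<Psi> P)"
    by metis
  define \<iota> where "\<iota> = (\<lambda>P. rep_equiv G H `` {\<Psi> P})"
  have "inj_on \<iota> ?PP"
  proof (rule inj_onI)
    fix P Q assume P: "P \<in> ?PP" and Q: "Q \<in> ?PP" and "\<iota> P = \<iota> Q"
    have hq: "rep P \<in> hom_quasimorphisms G" "rep Q \<in> hom_quasimorphisms G"
      using rep(2)[OF P] rep(2)[OF Q] by (auto simp: nonzero_hom_quasimorphisms_def)
    then have "\<forall>g\<in>carrier G. rep P g = rep Q g"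
      using induced_class_eq_iff[OF assms(1,3) H0 _ _ ind[OF P] ind[OF Q]] \<open>\<iota> P = \<iota> Q\<close>
      by (auto simp: \<iota>_def hom_quasimorphisms_def)
    then have "rep P = rep Q"
      using hq by (auto simp: hom_quasimorphisms_def intro: extensionalityI)
    then show "P = Q"
      using quotient_disj[OF equiv_proportional] P Q rep(1)[OF P] rep(1)[OF Q]
      unfolding projective_hom_quasimorphisms_def by (metis disjoint_iff)
  qed
  moreover have "\<iota> ` ?PP \<subseteq> representations G H // rep_equiv G H"
    using induced_representation_properties(1)[OF assms(1,3) ind]
    by (auto simp: \<iota>_def intro: quotientI)
  moreover have "\<exists>\<mu>\<in>P. \<exists>\<Psi>. induced_representation G H \<mu> \<Psi> \<and> \<iota> P = rep_equiv G H `` {\<Psi>}"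
    if "P \<in> ?PP" for P
    unfolding \<iota>_def by (intro bexI[OF _ rep(1)[OF that]] exI[of _ "\<Psi> P"] conjI ind that refl)
  ultimately show ?thesis by (intro exI[of _ \<iota>] conjI ballI)
qed

theorem lemma3p1:
  fixes G :: "('a, 'b) monoid_scheme" and H :: "real set"
  assumes "group G" and "countable (carrier G)"
    and "nonzero_hom_quasimorphisms G \<noteq> {}"
    and "H \<subseteq> {0<..<1}" and "discrete H" and "countable H" and "infinite H"
  shows
    "(\<forall>\<mu>\<in>nonzero_hom_quasimorphisms G.
        (\<exists>\<Psi>. induced_representation G H \<mu> \<Psi>) \<and>
        (\<forall>\<Psi>. induced_representation G H \<mu> \<Psi> \<longrightarrow>
           \<Psi> \<in> representations G H \<and> inj_on \<Psi> (carrier G)) \<and>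
        (\<forall>\<Psi> \<Psi>'. induced_representation G H \<mu> \<Psi> \<and> induced_representation G H \<mu> \<Psi>' \<longrightarrow>
           rep_equiv G H `` {\<Psi>} = rep_equiv G H `` {\<Psi>'})) \<and>
     (\<exists>\<iota>. inj_on \<iota> (projective_hom_quasimorphisms G) \<and>
          \<iota> ` projective_hom_quasimorphisms G \<subseteq> representations G H // rep_equiv G H \<and>
          (\<forall>P\<in>projective_hom_quasimorphisms G. \<exists>\<mu>\<in>P. \<exists>\<Psi>.
             induced_representation G H \<mu> \<Psi> \<and> \<iota> P = rep_equiv G H `` {\<Psi>})) \<and>
     (\<forall>\<mu>\<in>hom_quasimorphisms G. \<forall>m\<in>hom_quasimorphisms G. lin_independent2 G \<mu> m \<longrightarrow>
        (\<forall>\<Psi> \<Phi>. induced_representation G H \<mu> \<Psi> \<and> induced_representation G H m \<Phi> \<longrightarrow>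
           rep_equiv G H `` {\<Psi>} \<noteq> rep_equiv G H `` {\<Phi>}))"
proof (intro conjI ballI allI impI)
  have H0: "H \<noteq> {}" using \<open>infinite H\<close> by auto
  fix \<mu> assume \<mu>: "\<mu> \<in> nonzero_hom_quasimorphisms G"
  then have hom: "homogeneous G \<mu>"
    by (auto simp: nonzero_hom_quasimorphisms_def hom_quasimorphisms_def)
  show "\<exists>\<Psi>. induced_representation G H \<mu> \<Psi>"
    by (rule induced_representation_exists[OF assms(1,2,6,7) \<mu>])
  show "\<Psi> \<in> representations G H" "inj_on \<Psi> (carrier G)"
    if "induced_representation G H \<mu> \<Psi>" for \<Psi>
    using induced_representation_properties[OF assms(1,4) that] by auto
  show "rep_equiv G H `` {\<Psi>} = rep_equiv G H `` {\<Psi>'}"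
    if "induced_representation G H \<mu> \<Psi> \<and> induced_representation G H \<mu> \<Psi>'" for \<Psi> \<Psi>'
    using induced_class_eq_iff[OF assms(1,4) H0 hom hom] that by blast
next
  show "\<exists>\<iota>. inj_on \<iota> (projective_hom_quasimorphisms G) \<and>
      \<iota> ` projective_hom_quasimorphisms G \<subseteq> representations G H // rep_equiv G H \<and>
      (\<forall>P\<in>projective_hom_quasimorphisms G. \<exists>\<mu>\<in>P. \<exists>\<Psi>.
         induced_representation G H \<mu> \<Psi> \<and> \<iota> P = rep_equiv G H `` {\<Psi>})"
    by (rule projective_class_embedding[OF assms(1,2,4,6,7)])
next
  have H0: "H \<noteq> {}" using \<open>infinite H\<close> by auto
  fix \<mu> m \<Psi> \<Phi>
  assume hq: "\<mu> \<in> hom_quasimorphisms G" "m \<in> hom_quasimorphisms G"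
    and indep: "lin_independent2 G \<mu> m"
    and ind: "induced_representation G H \<mu> \<Psi> \<and> induced_representation G H m \<Phi>"
  show "rep_equiv G H `` {\<Psi>} \<noteq> rep_equiv G H `` {\<Phi>}"
  proof
    assume "rep_equiv G H `` {\<Psi>} = rep_equiv G H `` {\<Phi>}"
    then have "\<forall>g\<in>carrier G. \<mu> g = m g"
      using induced_class_eq_iff[OF assms(1,4) H0] hq ind by (auto simp: hom_quasimorphisms_def)
    then have "\<forall>g\<in>carrier G. 1 * \<mu> g + (-1) * m g = 0" by simp
    then have "(1::real) = 0" using indep unfolding lin_independent2_def by blast
    then show False by simp
  qed
qed

end
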